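(* Let $(L,[\cdot,\dots,\cdot],\varepsilon,\alpha,\beta)$ be a regular $n$-BiHom-Lie color algebra. Put $\omega(D)=D\circ\alpha$, $\Omega(D)=D\circ\beta$ and $[D_1,D_2]=D_1\circ D_2-\varepsilon(d_1,d_2)D_2\circ D_1$ for $D_1,D_2\in\widetilde{End}(L)$ homogeneous of degrees $d_1,d_2$. Then: 1) $GDer(L)$, $QDer(L)$ and $C(L)$ are color BiHom-subalgebras of $(\widetilde{End}(L),[\cdot,\cdot],\omega,\Omega)$, i.e. (a) $\omega(GDer(L))\subseteq GDer(L)$, $\Omega(GDer(L))\subseteq GDer(L)$ and $[GDer(L),GDer(L)]\subseteq GDer(L)$; (b) $\omega(QDer(L))\subseteq QDer(L)$, $\Omega(QDer(L))\subseteq QDer(L)$ and $[QDer(L),QDer(L)]\subseteq QDer(L)$; (c) $\omega(C(L))\subseteq C(L)$, $\Omega(C(L))\subseteq C(L)$ and $[C(L),C(L)]\subseteq C(L)$. 2) $ZDer(L)$ is a color BiHom-ideal of $Der(L)$, i.e. $\omega(ZDer(L))\subseteq ZDer(L)$, $\Omega(ZDer(L))\subseteq ZDer(L)$ and $[ZDer(L),Der(L)]\subseteq ZDer(L)$.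
   Context: $\mathbb K$ is a field of characteristic different from $2$, $\Gamma$ is an abelian group (written additively) with identity element $e$; $\mathcal H(L)$ is the set of homogeneous elements of a $\Gamma$-graded space $L$. A (skew-symmetric) bicharacter is a map $\varepsilon:\Gamma\times\Gamma\to\mathbb K^*$ with $\varepsilon(a,b)\varepsilon(b,a)=1$, $\varepsilon(a,b+c)=\varepsilon(a,b)\varepsilon(a,c)$, $\varepsilon(a+b,c)=\varepsilon(a,c)\varepsilon(b,c)$. Inside $\varepsilon$ a homogeneous element or map stands for its degree. A (multi)linear map is even if it has degree zero. An $n$-BiHom-Lie color algebra is a $5$-tuple $(L,[\cdot,\dots,\cdot],\varepsilon,\alpha,\beta)$ with $L$ a $\Gamma$-graded vector space, $[\cdot,\dots,\cdot]$ an even $n$-linear map on $L$, $\varepsilon$ a bicharacter and $\alpha,\beta:L\to L$ even linear maps such that, for all homogeneous elements: (1) $\alpha\circ\beta=\beta\circ\alpha$; (2) $[\beta(x_1),\dots,\beta(x_k),\beta(x_{k+1}),\dots,\beta(x_{n-1}),\alpha(x_n)]=-\varepsilon(x_k,x_{k+1})[\beta(x_1),\dots,\beta(x_{k+1}),\beta(x_k),\dots,\beta(x_{n-1}),\alpha(x_n)]$ for $k=1,\dots,n-2$, and $[\beta(x_1),\dots,\beta(x_{n-1}),\alpha(x_n)]=-\varepsilon(x_{n-1},x_n)[\beta(x_1),\dots,\beta(x_{n-2}),\beta(x_n),\alpha(x_{n-1})]$; (3) $[\beta^2(x_1),\dots,\beta^2(x_{n-1}),[\beta(y_1),\dots,\beta(y_{n-1}),\alpha(y_n)]]=\sum_{k=1}^n\varepsilon(X,Y_k)[\beta^2(y_1),\dots,\beta^2(y_{k-1}),[\beta(x_1),\dots,\beta(x_{n-1}),\alpha(y_k)],\beta^2(y_{k+1}),\dots,\beta^2(y_n)]$,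 where $X$ is the sum of the degrees of $x_1,\dots,x_{n-1}$ and $Y_k$ the sum of the degrees of $y_1,\dots,y_{k-1}$. It is regular if $\alpha$ and $\beta$ are even algebra automorphisms (bijective, and $\alpha([x_1,\dots,x_n])=[\alpha(x_1),\dots,\alpha(x_n)]$, likewise $\beta$). $\widetilde{End}(L)=\{f\in End(L): f\alpha=\alpha f,\ f\beta=\beta f\}$. Let $k,r\ge0$. All maps $D,D',\dots$ below are linear, homogeneous of degree $d$ and commute with $\alpha$ and $\beta$; the identities hold for all $x_1,\dots,x_n\in\mathcal H(L)$; $X_i$ is the sum of the degrees of $x_1,\dots,x_{i-1}$; and, for a linear map $E$, $T_i(E)$ abbreviates $\varepsilon(d,X_i)[\alpha^k\beta^r(x_1),\dots,\alpha^k\beta^r(x_{i-1}),E(x_i),\alpha^k\beta^r(x_{i+1}),\dots,\alpha^k\beta^r(x_n)]$. - $D\in Der_{(\alpha^k,\beta^r)}(L)$ if $D([x_1,\dots,x_n])=\sum_{i=1}^nT_i(D)$. - $D\in GDer_{(\alpha^k,\beta^r)}(L)$ if there exist $D',D'',\dots,D^{(n)}$ (of degree $d$, commuting with $\alpha,\beta$) with $D^{(n)}([x_1,\dots,x_n])=\sum_{i=1}^nT_i(D^{(i-1)})$, where $D^{(0)}=D$. - $D\in QDer_{(\alpha^k,\beta^r)}(L)$ if there exists $D'$ (of degree $d$, commuting with $\alpha,\beta$) with $D'([x_1,\dots,x_n])=\sum_{i=1}^nT_i(D)$. - $D\in C_{(\alpha^k,\beta^r)}(L)$ if $D([x_1,\dots,x_n])=T_i(D)$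 for every $i=1,\dots,n$. - $D\in ZDer_{(\alpha^k,\beta^r)}(L)$ if $D([x_1,\dots,x_n])=T_i(D)=0$ for every $i=1,\dots,n$. For each of $F\in\{Der,GDer,QDer,C,ZDer\}$, $F(L)=\bigoplus_{k,r\ge0}F_{(\alpha^k,\beta^r)}(L)$. Assertions about these direct sums are read on components of index $(k,r)$: for $D\in F_{(\alpha^k,\beta^r)}(L)$ and $D'\in F'_{(\alpha^l,\beta^s)}(L)$, $\omega(D)$, $\Omega(D)$ and $[D,D']$ carry indices $(k+1,r)$, $(k,r+1)$ and $(k+l,r+s)$ respectively. *)

theory Defs
  imports Complex_Main
begin

text \<open>
  The ground field is the type \<open>'k::field\<close>, the grading group is the type
  \<open>'g::ab_group_add\<close> (so the identity element \<open>e\<close> is \<open>0\<close>), and the underlying space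
  is the whole type \<open>'v\<close> with scalar multiplication \<open>scl\<close>. An \<open>n\<close>-ary bracket is a
  function on lists of which only the values on lists of length \<open>n\<close> matter;
  list positions count from \<open>0\<close>, so \<open>xs ! i\<close> is the usual \<open>x\<^sub>i\<^sub>+\<^sub>1\<close>.
\<close>

record ('k, 'g, 'v) bihom_color =
  scl :: "'k \<Rightarrow> 'v \<Rightarrow> 'v"
  piece :: "'g \<Rightarrow> 'v set"
  br :: "'v list \<Rightarrow> 'v"
  eps :: "'g \<Rightarrow> 'g \<Rightarrow> 'k"
  tw_a :: "'v \<Rightarrow> 'v"
  tw_b :: "'v \<Rightarrow> 'v"

definition graded_space :: "('k::field \<Rightarrow> 'v::ab_group_add \<Rightarrow> 'v) \<Rightarrow> ('g \<Rightarrow> 'v set) \<Rightarrow> bool" where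
  "graded_space s V \<longleftrightarrow>
     vector_space s \<and>
     (\<forall>g. module.subspace s (V g)) \<and>
     (\<forall>v. \<exists>!c. (\<forall>g. c g \<in> V g) \<and> finite {g. c g \<noteq> 0} \<and> v = (\<Sum>g | c g \<noteq> 0. c g))"

definition bicharacter :: "('g::ab_group_add \<Rightarrow> 'g \<Rightarrow> 'k::field) \<Rightarrow> bool" where
  "bicharacter \<epsilon> \<longleftrightarrow>
     (\<forall>a b. \<epsilon> a b \<noteq> 0) \<and>
     (\<forall>a b. \<epsilon> a b * \<epsilon> b a = 1) \<and>
     (\<forall>a b c. \<epsilon> a (b + c) = \<epsilon> a b * \<epsilon> a c) \<and>
     (\<forall>a b c. \<epsilon> (a + b) c = \<epsilon> a c * \<epsilon> b c)"

text \<open>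
  \<open>homs L ds xs\<close>: the entries of \<open>xs\<close> are homogeneous, of degrees \<open>ds\<close>. The degrees are
  carried along explicitly; only for zero entries are they not determined by \<open>xs\<close>, and then
  both sides of all the identities below vanish.
\<close>

definition homs :: "('k, 'g, 'v) bihom_color \<Rightarrow> 'g list \<Rightarrow> 'v list \<Rightarrow> bool" where
  "homs L ds xs \<longleftrightarrow> list_all2 (\<lambda>d x. x \<in> piece L d) ds xs"

definition hom_linear ::
    "('k::field, 'g::ab_group_add, 'v::ab_group_add) bihom_color \<Rightarrow> 'g \<Rightarrow> ('v \<Rightarrow> 'v) \<Rightarrow> bool" where
  "hom_linear L d f \<longleftrightarrow>
     Vector_Spaces.linear (scl L) (scl L) f \<and> (\<forall>g. \<forall>x\<in>piece L g. f x \<in> piece L (d + g))"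

definition even_multilinear ::
    "nat \<Rightarrow> ('k::field, 'g::ab_group_add, 'v::ab_group_add) bihom_color \<Rightarrow> bool" where
  "even_multilinear n L \<longleftrightarrow>
     (\<forall>xs i. length xs = n \<longrightarrow> i < n \<longrightarrow>
        Vector_Spaces.linear (scl L) (scl L) (\<lambda>v. br L (xs[i := v]))) \<and>
     (\<forall>ds xs. length xs = n \<longrightarrow> homs L ds xs \<longrightarrow> br L xs \<in> piece L (sum_list ds))"

text \<open>\<open>twist L [x\<^sub>1, \<dots>, x\<^sub>n] = [\<beta> x\<^sub>1, \<dots>, \<beta> x\<^sub>n\<^sub>-\<^sub>1, \<alpha> x\<^sub>n]\<close>\<close>

definition twist :: "('k, 'g, 'v) bihom_color \<Rightarrow> 'v list \<Rightarrow> 'v list" where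
  "twist L xs = map (tw_b L) (butlast xs) @ [tw_a L (last xs)]"

text \<open>
  Both skew-symmetry identities (the one for \<open>k \<le> n - 2\<close> and the one exchanging the last two
  arguments) say that exchanging two neighbours inside \<open>twist\<close> produces the factor
  \<open>- \<epsilon>(x\<^sub>k, x\<^sub>k\<^sub>+\<^sub>1)\<close>.
\<close>

definition bihom_skew ::
    "nat \<Rightarrow> ('k::field, 'g::ab_group_add, 'v::ab_group_add) bihom_color \<Rightarrow> bool" where
  "bihom_skew n L \<longleftrightarrow>
     (\<forall>ds xs k. length xs = n \<longrightarrow> homs L ds xs \<longrightarrow> Suc k < n \<longrightarrow>
        br L (twist L xs) =
          scl L (- eps L (ds ! k) (ds ! Suc k))
            (br L (twist L (xs[k := xs ! Suc k, Suc k := xs ! k]))))"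

definition bihom_jacobi ::
    "nat \<Rightarrow> ('k::field, 'g::ab_group_add, 'v::ab_group_add) bihom_color \<Rightarrow> bool" where
  "bihom_jacobi n L \<longleftrightarrow>
     (\<forall>dx xs dy ys. length xs = n - 1 \<longrightarrow> length ys = n \<longrightarrow> homs L dx xs \<longrightarrow> homs L dy ys \<longrightarrow>
        br L (map (tw_b L \<circ> tw_b L) xs @ [br L (twist L ys)]) =
          (\<Sum>k<n. scl L (eps L (sum_list dx) (sum_list (take k dy)))
             (br L ((map (tw_b L \<circ> tw_b L) ys)[k := br L (twist L (xs @ [ys ! k]))]))))"

definition n_bihom_lie_color_algebra ::
    "nat \<Rightarrow> ('k::field, 'g::ab_group_add, 'v::ab_group_add) bihom_color \<Rightarrow> bool" where
  "n_bihom_lie_color_algebra n L \<longleftrightarrow>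
     2 \<le> n \<and>
     graded_space (scl L) (piece L) \<and>
     even_multilinear n L \<and>
     bicharacter (eps L) \<and>
     hom_linear L 0 (tw_a L) \<and>
     hom_linear L 0 (tw_b L) \<and>
     tw_a L \<circ> tw_b L = tw_b L \<circ> tw_a L \<and>
     bihom_skew n L \<and>
     bihom_jacobi n L"

definition regular ::
    "nat \<Rightarrow> ('k::field, 'g::ab_group_add, 'v::ab_group_add) bihom_color \<Rightarrow> bool" where
  "regular n L \<longleftrightarrow>
     bij (tw_a L) \<and> bij (tw_b L) \<and>
     (\<forall>xs. length xs = n \<longrightarrow> tw_a L (br L xs) = br L (map (tw_a L) xs)) \<and>
     (\<forall>xs. length xs = n \<longrightarrow> tw_b L (br L xs) = br L (map (tw_b L) xs))"

text \<open>The homogeneous elements of degree \<open>d\<close> of the space of endomorphisms commuting with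
  \<open>\<alpha>\<close> and \<open>\<beta>\<close>.\<close>

definition End_tilde ::
    "('k::field, 'g::ab_group_add, 'v::ab_group_add) bihom_color \<Rightarrow> 'g \<Rightarrow> ('v \<Rightarrow> 'v) set" where
  "End_tilde L d =
     {D. hom_linear L d D \<and> D \<circ> tw_a L = tw_a L \<circ> D \<and> D \<circ> tw_b L = tw_b L \<circ> D}"

text \<open>\<open>T_term L k r d ds xs i E\<close> is \<open>T\<^sub>i\<^sub>+\<^sub>1(E)\<close>, since positions count from \<open>0\<close>.\<close>

definition T_term ::
    "('k::field, 'g::ab_group_add, 'v::ab_group_add) bihom_color \<Rightarrow> nat \<Rightarrow> nat \<Rightarrow> 'g \<Rightarrow>
     'g list \<Rightarrow> 'v list \<Rightarrow> nat \<Rightarrow> ('v \<Rightarrow> 'v) \<Rightarrow> 'v" where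
  "T_term L k r d ds xs i E =
     scl L (eps L d (sum_list (take i ds)))
       (br L ((map ((tw_a L ^^ k) \<circ> (tw_b L ^^ r)) xs)[i := E (xs ! i)]))"

text \<open>For each of the five families, \<open>F n L k r d\<close> is the set of maps of degree \<open>d\<close> in the
  component of index \<open>(k, r)\<close>.\<close>

definition Der ::
    "nat \<Rightarrow> ('k::field, 'g::ab_group_add, 'v::ab_group_add) bihom_color \<Rightarrow> nat \<Rightarrow> nat \<Rightarrow> 'g \<Rightarrow>
     ('v \<Rightarrow> 'v) set" where
  "Der n L k r d =
     {D \<in> End_tilde L d. \<forall>ds xs. length xs = n \<longrightarrow> homs L ds xs \<longrightarrow>
        D (br L xs) = (\<Sum>i<n. T_term L k r d ds xs i D)}"

definition GDer ::
    "nat \<Rightarrow> ('k::field, 'g::ab_group_add, 'v::ab_group_add) bihom_color \<Rightarrow> nat \<Rightarrow> nat \<Rightarrow> 'g \<Rightarrow>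
     ('v \<Rightarrow> 'v) set" where
  "GDer n L k r d =
     {D \<in> End_tilde L d. \<exists>E :: nat \<Rightarrow> 'v \<Rightarrow> 'v.
        E 0 = D \<and> (\<forall>i\<in>{1..n}. E i \<in> End_tilde L d) \<and>
        (\<forall>ds xs. length xs = n \<longrightarrow> homs L ds xs \<longrightarrow>
           E n (br L xs) = (\<Sum>i<n. T_term L k r d ds xs i (E i)))}"

definition QDer ::
    "nat \<Rightarrow> ('k::field, 'g::ab_group_add, 'v::ab_group_add) bihom_color \<Rightarrow> nat \<Rightarrow> nat \<Rightarrow> 'g \<Rightarrow>
     ('v \<Rightarrow> 'v) set" where
  "QDer n L k r d =
     {D \<in> End_tilde L d. \<exists>D'\<in>End_tilde L d. \<forall>ds xs. length xs = n \<longrightarrow> homs L ds xs \<longrightarrow>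
        D' (br L xs) = (\<Sum>i<n. T_term L k r d ds xs i D)}"

definition Centroid ::
    "nat \<Rightarrow> ('k::field, 'g::ab_group_add, 'v::ab_group_add) bihom_color \<Rightarrow> nat \<Rightarrow> nat \<Rightarrow> 'g \<Rightarrow>
     ('v \<Rightarrow> 'v) set" where
  "Centroid n L k r d =
     {D \<in> End_tilde L d. \<forall>ds xs. length xs = n \<longrightarrow> homs L ds xs \<longrightarrow>
        (\<forall>i<n. D (br L xs) = T_term L k r d ds xs i D)}"

definition ZDer ::
    "nat \<Rightarrow> ('k::field, 'g::ab_group_add, 'v::ab_group_add) bihom_color \<Rightarrow> nat \<Rightarrow> nat \<Rightarrow> 'g \<Rightarrow>
     ('v \<Rightarrow> 'v) set" where
  "ZDer n L k r d =
     {D \<in> End_tilde L d. \<forall>ds xs. length xs = n \<longrightarrow> homs L ds xs \<longrightarrow>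
        (\<forall>i<n. D (br L xs) = T_term L k r d ds xs i D \<and> T_term L k r d ds xs i D = 0)}"

definition omega :: "('k, 'g, 'v) bihom_color \<Rightarrow> ('v \<Rightarrow> 'v) \<Rightarrow> 'v \<Rightarrow> 'v" where
  "omega L D = D \<circ> tw_a L"

definition Omega :: "('k, 'g, 'v) bihom_color \<Rightarrow> ('v \<Rightarrow> 'v) \<Rightarrow> 'v \<Rightarrow> 'v" where
  "Omega L D = D \<circ> tw_b L"

text \<open>The color commutator of maps of degrees \<open>d\<^sub>1\<close> and \<open>d\<^sub>2\<close>.\<close>

definition comm ::
    "('k, 'g, 'v::ab_group_add) bihom_color \<Rightarrow> 'g \<Rightarrow> 'g \<Rightarrow> ('v \<Rightarrow> 'v) \<Rightarrow> ('v \<Rightarrow> 'v) \<Rightarrow> 'v \<Rightarrow> 'v" where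
  "comm L d1 d2 D1 D2 = (\<lambda>x. D1 (D2 x) - scl L (eps L d1 d2) (D2 (D1 x)))"

end

(* Expanding D(D'[x_1,...,x_n]) gives a double sum over the two slots (i, j) where D' and D act.
   For i \<noteq> j the (i, j) term of D D' is \<epsilon>(d, d') times the corresponding term of D' D, because D and
   D' commute with the twist maps; so only the diagonal survives in the colour commutator.
   For ZDer, the off-diagonal terms vanish individually, hence so does the diagonal one. *)
theory Submission
  imports Defs
begin

section \<open>Iterates of commuting maps and degree sums of prefixes\<close>

lemma funpow_comm_apply:
  assumes "\<And>x. f (g x) = g (f x)"
  shows "f ((g ^^ k) x) = (g ^^ k) (f x)"
  using assms by (induction k) auto

text \<open>Source of the extra sign in a composite: once a map of degree \<open>d\<close> has acted
  on slot \<open>i\<close>, a second map reaching slot \<open>j\<close> passes the additional degree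
  \<open>d\<close> exactly when \<open>i < j\<close>.\<close>

lemma sum_list_take_update:
  fixes ds :: "'g::ab_group_add list"
  assumes "i < length ds"
  shows "sum_list (take j (ds[i := d + ds ! i])) =
    sum_list (take j ds) + (if i < j then d else 0)"
  using assms
proof (induction ds arbitrary: i j)
  case (Cons a ds)
  then show ?case
    by (cases i; cases j) (auto simp: algebra_simps)
qed simp

section \<open>The ambient algebra: bicharacter, grading and twist maps\<close>

locale regular_bihom_color =
  fixes n :: nat and L :: "('k::field, 'g::ab_group_add, 'v::ab_group_add) bihom_color"
  assumes algebra: "n_bihom_lie_color_algebra n L"
    and regular: "regular n L"
begin

sublocale vector_space "scl L"
  using algebra unfolding n_bihom_lie_color_algebra_def graded_space_def by blast

text \<open>A single name for all twists lets \<open>omega\<close> and \<open>Omega\<close> be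
  handled together, as precomposition with \<open>ph 1 0\<close> and \<open>ph 0 1\<close>.\<close>

definition ph :: "nat \<Rightarrow> nat \<Rightarrow> 'v \<Rightarrow> 'v" where
  "ph k r = (tw_a L ^^ k) \<circ> (tw_b L ^^ r)"

lemma two_le_n: "2 \<le> n"
  using algebra unfolding n_bihom_lie_color_algebra_def by blast

lemma eps_nonzero [simp]: "eps L a b \<noteq> 0"
  and eps_inverse: "eps L a b * eps L b a = 1"
  and eps_add_right: "eps L a (b + c) = eps L a b * eps L a c"
  and eps_add_left: "eps L (a + b) c = eps L a c * eps L b c"
  using algebra unfolding n_bihom_lie_color_algebra_def bicharacter_def by blast+

text \<open>The value is a nonzero idempotent of the field.\<close>

lemma eps_zero_right [simp]: "eps L a 0 = 1"
  using eps_add_right[of a 0 0] by simp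

lemma piece_subspace: "subspace (piece L g)"
  using algebra unfolding n_bihom_lie_color_algebra_def graded_space_def by blast

lemma tw_commute: "tw_a L (tw_b L x) = tw_b L (tw_a L x)"
  using algebra unfolding n_bihom_lie_color_algebra_def by (metis comp_apply)

lemma br_slot_hom:
  assumes "length xs = n" "i < n"
  shows "module_hom (scl L) (scl L) (\<lambda>v. br L (xs[i := v]))"
  using algebra assms
  unfolding n_bihom_lie_color_algebra_def even_multilinear_def Vector_Spaces.linear_def by blast

lemma hom_linear_hom: "hom_linear L d f \<Longrightarrow> module_hom (scl L) (scl L) f"
  unfolding hom_linear_def Vector_Spaces.linear_def by blast

lemma hom_linearI:
  assumes "module_hom (scl L) (scl L) f"
    and "\<And>g x. x \<in> piece L g \<Longrightarrow> f x \<in> piece L (d + g)"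
  shows "hom_linear L d f"
  using assms vector_space_axioms
  unfolding hom_linear_def Vector_Spaces.linear_def by blast

lemma hom_linear_comp:
  assumes f: "hom_linear L d f" and g: "hom_linear L e g"
  shows "hom_linear L (d + e) (f \<circ> g)"
proof (rule hom_linearI)
  show "module_hom (scl L) (scl L) (f \<circ> g)"
    using f g by (metis hom_linear_hom module_hom_compose)
next
  fix h x assume "x \<in> piece L h"
  then have "f (g x) \<in> piece L (d + (e + h))"
    using f g unfolding hom_linear_def by blast
  then show "(f \<circ> g) x \<in> piece L (d + e + h)" by (simp add: add.assoc)
qed

section \<open>Homogeneous endomorphisms commuting with the twists\<close>

lemma End_tildeD:
  assumes "D \<in> End_tilde L d"
  shows "module_hom (scl L) (scl L) D"
    and "\<And>x g. x \<in> piece L g \<Longrightarrow> D x \<in> piece L (d + g)"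
    and "\<And>x. D (tw_a L x) = tw_a L (D x)" and "\<And>x. D (tw_b L x) = tw_b L (D x)"
  using assms unfolding End_tilde_def hom_linear_def Vector_Spaces.linear_def
  by (auto simp: fun_eq_iff)

lemma End_tilde_ph: "D \<in> End_tilde L d \<Longrightarrow> D (ph k r x) = ph k r (D x)"
  by (simp add: ph_def funpow_comm_apply End_tildeD)

lemma End_tilde_comp:
  assumes "D \<in> End_tilde L d" "E \<in> End_tilde L e"
  shows "D \<circ> E \<in> End_tilde L (d + e)"
  using assms hom_linear_comp[of d D e E] unfolding End_tilde_def by (auto simp: fun_eq_iff)

lemma tw_End_tilde: "tw_a L \<in> End_tilde L 0" "tw_b L \<in> End_tilde L 0"
  using algebra unfolding n_bihom_lie_color_algebra_def End_tilde_def by auto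

lemma id_End_tilde: "id \<in> End_tilde L 0"
  by (simp add: End_tilde_def hom_linear_def linear_id)

lemma End_tilde_funpow: "D \<in> End_tilde L 0 \<Longrightarrow> D ^^ k \<in> End_tilde L 0"
proof (induction k)
  case (Suc k)
  then show ?case using End_tilde_comp[of D 0 "D ^^ k" 0] by (simp add: comp_def)
qed (simp only: funpow.simps id_End_tilde)

lemma ph_End_tilde: "ph k r \<in> End_tilde L 0"
  using End_tilde_comp[OF End_tilde_funpow End_tilde_funpow, OF tw_End_tilde]
  by (simp add: ph_def)

lemma comp_ph_End_tilde: "D \<in> End_tilde L d \<Longrightarrow> D \<circ> ph k r \<in> End_tilde L d"
  using End_tilde_comp[OF _ ph_End_tilde] by force

text \<open>Since \<alpha> and \<beta> commute, the power of \<beta> moves past the power of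
  \<alpha>. This is why indices add under composition.\<close>

lemma ph_ph: "ph k r (ph l s x) = ph (k + l) (r + s) x"
proof -
  have "(tw_b L ^^ r) (tw_a L y) = tw_a L ((tw_b L ^^ r) y)" for y
    by (rule funpow_comm_apply[symmetric]) (rule tw_commute)
  then have "(tw_b L ^^ r) ((tw_a L ^^ l) y) = (tw_a L ^^ l) ((tw_b L ^^ r) y)" for y
    by (rule funpow_comm_apply)
  then show ?thesis by (simp add: ph_def funpow_add)
qed

lemma funpow_br:
  assumes "\<And>xs. length xs = n \<Longrightarrow> f (br L xs) = br L (map f xs)" "length xs = n"
  shows "(f ^^ k) (br L xs) = br L (map (f ^^ k) xs)"
  by (induction k) (use assms in \<open>auto simp: comp_def\<close>)

text \<open>Regularity enters here: multiplicativity of \<alpha> and \<beta> passes to their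
  iterates and then to the composite.\<close>

lemma ph_br: "length xs = n \<Longrightarrow> ph k r (br L xs) = br L (map (ph k r) xs)"
  using regular unfolding regular_def ph_def by (simp add: funpow_br)

text \<open>Both composites have the same degree because the grading group is abelian, and each
  graded piece is a subspace.\<close>

lemma comm_End_tilde:
  assumes "D \<in> End_tilde L d" "E \<in> End_tilde L e"
  shows "comm L d e D E \<in> End_tilde L (d + e)"
proof -
  have DE: "D \<circ> E \<in> End_tilde L (d + e)" and ED: "E \<circ> D \<in> End_tilde L (d + e)"
    using End_tilde_comp[OF assms] End_tilde_comp[OF assms(2,1)] by (auto simp: add.commute)
  have c: "comm L d e D E = (\<lambda>x. (D \<circ> E) x - scl L (eps L d e) ((E \<circ> D) x))"
    by (simp add: comm_def)
  interpret module_pair "scl L" "scl L" ..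
  have "module_hom (scl L) (scl L) (comm L d e D E)"
    unfolding c by (intro module_hom_sub module_hom_scale End_tildeD(1)[OF DE] End_tildeD(1)[OF ED])
  moreover have "comm L d e D E x \<in> piece L (d + e + g)" if "x \<in> piece L g" for x g
    unfolding c using that End_tildeD(2)[OF DE] End_tildeD(2)[OF ED]
    by (intro subspace_diff subspace_scale piece_subspace)
  ultimately have "hom_linear L (d + e) (comm L d e D E)" by (rule hom_linearI)
  \<comment> \<open>The twists are linear, so they pass through the difference and the
    scalar.\<close>
  then show ?thesis
    using End_tildeD(3,4)[OF assms(1)] End_tildeD(3,4)[OF assms(2)]
      End_tildeD(1)[OF tw_End_tilde(1)] End_tildeD(1)[OF tw_End_tilde(2)]
    by (auto simp: End_tilde_def comm_def fun_eq_iff module_hom.diff module_hom.scale)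
qed

section \<open>Homogeneous argument lists and the terms T_i\<close>

lemma homs_length: "homs L ds xs \<Longrightarrow> length ds = length xs"
  by (simp add: homs_def list_all2_lengthD)

lemma homs_map_ph: "homs L ds xs \<Longrightarrow> homs L ds (map (ph k r) xs)"
  unfolding homs_def list_all2_map2
  by (rule list_all2_mono) (use End_tildeD(2)[OF ph_End_tilde] in force)+

text \<open>Makes the identity of a second map applicable to the arguments that a first map has
  produced.\<close>

lemma homs_slot:
  assumes "homs L ds xs" "i < length xs" "D \<in> End_tilde L d"
  shows "homs L (ds[i := d + ds ! i]) ((map (ph k r) xs)[i := D (xs ! i)])"
proof -
  have "homs L ds (map (ph k r) xs)" by (rule homs_map_ph) fact
  moreover have "D (xs ! i) \<in> piece L (d + ds ! i)"
    using assms End_tildeD(2)[OF assms(3)] by (auto simp: homs_def list_all2_conv_all_nth)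
  ultimately show ?thesis unfolding homs_def by (rule list_all2_update_cong)
qed

lemma T_term_ph:
  "T_term L k r d ds xs i E =
    scl L (eps L d (sum_list (take i ds))) (br L ((map (ph k r) xs)[i := E (xs ! i)]))"
  by (simp add: T_term_def ph_def)

text \<open>Outside slot \<open>i\<close> the two twists merge by \<open>ph_ph\<close>; in slot
  \<open>i\<close> the inner one is absorbed into \<open>E\<close>. The sign is unchanged, as twists
  have degree zero and keep \<open>ds\<close>.\<close>

lemma T_term_map_ph:
  assumes "i < length xs"
  shows "T_term L k r d ds (map (ph a b) xs) i E = T_term L (k + a) (r + b) d ds xs i (E \<circ> ph a b)"
  using assms by (simp add: T_term_ph ph_ph comp_def)

lemma T_term_comm:
  assumes "length xs = n" "i < n"
  shows "T_term L k r (d + d') ds xs i (comm L d d' D D') =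
    T_term L k r (d + d') ds xs i (D \<circ> D') -
    scl L (eps L d d') (T_term L k r (d + d') ds xs i (D' \<circ> D))"
proof -
  interpret h: module_hom "scl L" "scl L" "\<lambda>v. br L ((map (ph k r) xs)[i := v])"
    by (rule br_slot_hom) (use assms in auto)
  show ?thesis
    by (simp add: T_term_ph comm_def h.diff h.scale scale_right_diff_distrib mult.commute)
qed

section \<open>Generalised derivation identities\<close>

text \<open>Common form of three families: \<open>Der\<close> has constant \<open>E\<close> equal to
  \<open>F\<close>, \<open>QDer\<close> has constant \<open>E\<close> and free \<open>F\<close>,
  \<open>GDer\<close> has \<open>F = E n\<close>. Closure is thus proved once.\<close>

definition gder ::
    "nat \<Rightarrow> nat \<Rightarrow> 'g \<Rightarrow> (nat \<Rightarrow> 'v \<Rightarrow> 'v) \<Rightarrow> ('v \<Rightarrow> 'v) \<Rightarrow> bool" where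
  "gder k r d E F \<longleftrightarrow> F \<in> End_tilde L d \<and> (\<forall>i<n. E i \<in> End_tilde L d) \<and>
     (\<forall>ds xs. length xs = n \<longrightarrow> homs L ds xs \<longrightarrow>
        F (br L xs) = (\<Sum>i<n. T_term L k r d ds xs i (E i)))"

lemma gderD:
  assumes "gder k r d E F"
  shows "F \<in> End_tilde L d" "\<And>i. i < n \<Longrightarrow> E i \<in> End_tilde L d"
    "\<And>ds xs. length xs = n \<Longrightarrow> homs L ds xs \<Longrightarrow>
        F (br L xs) = (\<Sum>i<n. T_term L k r d ds xs i (E i))"
  using assms unfolding gder_def by blast+

lemma Der_gder: "D \<in> Der n L k r d \<Longrightarrow> gder k r d (\<lambda>_. D) D"
  unfolding Der_def gder_def by blast

lemma QDer_gder: "D \<in> QDer n L k r d \<longleftrightarrow> (\<exists>F. gder k r d (\<lambda>_. D) F)"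
  \<comment> \<open>Slot 0 exists, so the condition on all slot maps does yield
    \<open>D \<in> End_tilde L d\<close>.\<close>
  using two_le_n unfolding QDer_def gder_def by (auto intro: exI[of _ 0])

text \<open>Slots carry \<open>E 0\<close> to \<open>E (n - 1)\<close> and the bracket carries
  \<open>E n\<close>; hence the range \<open>{1..n}\<close> together with \<open>E 0 = D\<close>
  covers the slot maps and the outer map.\<close>

lemma GDer_gder: "D \<in> GDer n L k r d \<longleftrightarrow> (\<exists>E. E 0 = D \<and> gder k r d E (E n))"
proof
  assume "D \<in> GDer n L k r d"
  then obtain E where E: "D \<in> End_tilde L d" "E 0 = D" "\<forall>i\<in>{1..n}. E i \<in> End_tilde L d"
    and eq: "\<forall>ds xs. length xs = n \<longrightarrow> homs L ds xs \<longrightarrow>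
        E n (br L xs) = (\<Sum>i<n. T_term L k r d ds xs i (E i))"
    unfolding GDer_def by blast
  have "E i \<in> End_tilde L d" if "i \<le> n" for i
    using E that by (cases i) auto
  with eq E(2) show "\<exists>E. E 0 = D \<and> gder k r d E (E n)" unfolding gder_def by auto
next
  assume "\<exists>E. E 0 = D \<and> gder k r d E (E n)"
  then obtain E where E: "E 0 = D" "gder k r d E (E n)" by blast
  have "E i \<in> End_tilde L d" if "i \<le> n" for i
    using gderD(1,2)[OF E(2)] that by (cases "i = n") auto
  with E gderD(3)[OF E(2)] show "D \<in> GDer n L k r d"
    unfolding GDer_def by (auto intro!: exI[of _ E])
qed

text \<open>Apply the identity to the twisted arguments; \<open>ph_br\<close> turns their bracket
  into the twisted bracket.\<close>

lemma gder_comp_ph: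
  assumes "gder k r d E F"
  shows "gder (k + a) (r + b) d (\<lambda>i. E i \<circ> ph a b) (F \<circ> ph a b)"
proof -
  have "F (ph a b (br L xs)) = (\<Sum>i<n. T_term L (k + a) (r + b) d ds xs i (E i \<circ> ph a b))"
    if "length xs = n" "homs L ds xs" for ds xs
    using that gderD(3)[OF assms, of "map (ph a b) xs" ds]
    by (simp add: ph_br homs_map_ph T_term_map_ph)
  then show ?thesis
    using gderD(1,2)[OF assms] by (simp add: gder_def comp_ph_End_tilde)
qed

section \<open>Composites of two maps, slot by slot\<close>

text \<open>The term of \<open>D (D' [x\<^sub>1, \<dots>, x\<^sub>n])\<close> in which \<open>D'\<close> acts on slot \<open>i\<close> and \<open>D\<close> acts on
  slot \<open>j\<close>. When \<open>i < j\<close>, \<open>D\<close> also passes the degree \<open>d'\<close> that \<open>D'\<close> has added in front of it.\<close>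

definition pair_term ::
    "nat \<Rightarrow> nat \<Rightarrow> 'g \<Rightarrow> nat \<Rightarrow> nat \<Rightarrow> 'g \<Rightarrow> 'g list \<Rightarrow> 'v list \<Rightarrow> nat \<Rightarrow> nat \<Rightarrow>
     ('v \<Rightarrow> 'v) \<Rightarrow> ('v \<Rightarrow> 'v) \<Rightarrow> 'v" where
  "pair_term k r d l s d' ds xs i j D D' =
     scl L (eps L d' (sum_list (take i ds)) * eps L d (sum_list (take j ds)) *
         (if i < j then eps L d d' else 1))
       (br L (if i = j then (map (ph (k + l) (r + s)) xs)[i := D (D' (xs ! i))]
         else (map (ph (k + l) (r + s)) xs)[i := ph k r (D' (xs ! i)), j := ph l s (D (xs ! j))]))"

text \<open>On the diagonal the second update overwrites the first. Off the diagonal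
  \<open>D\<close> commutes with \<open>ph l s\<close>, and additivity of \<epsilon> in its second
  argument splits off the factor \<epsilon>(d, d') when \<open>i < j\<close>.\<close>

lemma T_term_slot:
  assumes "length xs = n" "homs L ds xs" "i < n" "j < n" "D \<in> End_tilde L d"
  shows "scl L (eps L d' (sum_list (take i ds)))
      (T_term L k r d (ds[i := d' + ds ! i]) ((map (ph l s) xs)[i := D' (xs ! i)]) j D) =
    pair_term k r d l s d' ds xs i j D D'"
  using assms homs_length[OF assms(2)]
  by (simp add: T_term_ph pair_term_def sum_list_take_update eps_add_right map_update ph_ph
      End_tilde_ph comp_def list_update_overwrite mult.assoc)

text \<open>One row of the double sum. Here \<open>D'\<close> is any element of
  \<open>End_tilde\<close>, so the same expansion serves the ideal property of
  \<open>ZDer\<close>.\<close>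

lemma gder_T_term:
  assumes D: "gder k r d E F" and D': "D' \<in> End_tilde L d'"
    and xs: "length xs = n" "homs L ds xs" and i: "i < n"
  shows "F (T_term L l s d' ds xs i D') = (\<Sum>j<n. pair_term k r d l s d' ds xs i j (E j) D')"
proof -
  let ?ys = "(map (ph l s) xs)[i := D' (xs ! i)]" and ?es = "ds[i := d' + ds ! i]"
  interpret F: module_hom "scl L" "scl L" F
    by (rule End_tildeD(1)[OF gderD(1)[OF D]])
  have "F (br L ?ys) = (\<Sum>j<n. T_term L k r d ?es ?ys j (E j))"
    by (rule gderD(3)[OF D]) (use xs i D' homs_slot in auto)
  then show ?thesis
    unfolding T_term_ph[of l s]
    by (simp add: F.scale scale_sum_right T_term_slot[OF xs i _ gderD(2)[OF D]])
qed

lemma pair_term_swap: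
  assumes "i \<noteq> j"
  shows "pair_term k r d l s d' ds xs i j D D' =
    scl L (eps L d d') (pair_term l s d' k r d ds xs j i D' D)"
proof -
  \<comment> \<open>For \<open>j < i\<close> the right side is \<epsilon>(d, d') \<epsilon>(d', d) =
    1. Apart from this sign, only the order of updates at two distinct positions differs.\<close>
  have "(if i < j then eps L d d' else 1) = eps L d d' * (if j < i then eps L d' d else 1)"
    using assms by (auto simp: eps_inverse)
  then show ?thesis
    using assms by (simp add: pair_term_def list_update_swap ac_simps)
qed

text \<open>Additivity of \<epsilon> in its first argument merges the two signs into that of a map
  of degree \<open>d + d'\<close>.\<close>

lemma pair_term_diag:
  "pair_term k r d l s d' ds xs i i D D' = T_term L (k + l) (r + s) (d + d') ds xs i (D \<circ> D')"
  by (simp add: pair_term_def T_term_ph eps_add_left mult.commute)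

lemma gder_comm:
  assumes D: "gder k r d E F" and D': "gder l s d' E' F'"
  shows "gder (k + l) (r + s) (d + d') (\<lambda>i. comm L d d' (E i) (E' i)) (comm L d d' F F')"
  unfolding gder_def
proof (intro conjI allI impI)
  show "comm L d d' F F' \<in> End_tilde L (d + d')"
    by (intro comm_End_tilde gderD(1)[OF D] gderD(1)[OF D'])
  show "comm L d d' (E i) (E' i) \<in> End_tilde L (d + d')" if "i < n" for i
    using that by (intro comm_End_tilde gderD(2)[OF D] gderD(2)[OF D'])
next
  fix ds xs assume xs: "length xs = n" "homs L ds xs"
  let ?W = "\<lambda>i j. pair_term k r d l s d' ds xs i j (E j) (E' i)"
  let ?W' = "\<lambda>j i. pair_term l s d' k r d ds xs j i (E' i) (E j)"
  interpret F: module_hom "scl L" "scl L" F by (rule End_tildeD(1)[OF gderD(1)[OF D]])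
  interpret F': module_hom "scl L" "scl L" F' by (rule End_tildeD(1)[OF gderD(1)[OF D']])
  have 1: "F (F' (br L xs)) = (\<Sum>i<n. \<Sum>j<n. ?W i j)"
    by (simp add: gderD(3)[OF D' xs] F.sum gder_T_term[OF D gderD(2)[OF D'] xs])
  have "F' (F (br L xs)) = (\<Sum>j<n. \<Sum>i<n. ?W' j i)"
    by (simp add: gderD(3)[OF D xs] F'.sum gder_T_term[OF D' gderD(2)[OF D] xs])
  \<comment> \<open>Exchanging the sums makes \<open>i\<close> the slot of the primed maps in both
    expansions, so that they can be compared term by term.\<close>
  also have "\<dots> = (\<Sum>i<n. \<Sum>j<n. ?W' j i)" by (rule sum.swap)
  finally have 2: "F' (F (br L xs)) = (\<Sum>i<n. \<Sum>j<n. ?W' j i)" .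
  have "comm L d d' F F' (br L xs) = (\<Sum>i<n. \<Sum>j<n. ?W i j - scl L (eps L d d') (?W' j i))"
    by (simp only: comm_def 1 2 scale_sum_right sum_subtractf)
  also have "\<dots> = (\<Sum>i<n. \<Sum>j<n. if i = j
      then T_term L (k + l) (r + s) (d + d') ds xs i (comm L d d' (E i) (E' i)) else 0)"
  proof (intro sum.cong refl)
    fix i j assume "i \<in> {..<n}" "j \<in> {..<n}"
    then show "?W i j - scl L (eps L d d') (?W' j i) = (if i = j
      then T_term L (k + l) (r + s) (d + d') ds xs i (comm L d d' (E i) (E' i)) else 0)"
      \<comment> \<open>Off the diagonal \<open>pair_term_swap\<close> gives cancellation. On it the
        two composites form the commutator in slot \<open>i\<close>, once the indices and degree of
        the second are reordered.\<close>
      using xs by (auto simp: pair_term_swap[of i j k r d l s d'] pair_term_diag T_term_comm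
          add.commute[of l k] add.commute[of s r] add.commute[of d' d])
  qed
  finally show "comm L d d' F F' (br L xs) = (\<Sum>i<n. T_term L (k + l) (r + s) (d + d') ds xs i
      (comm L d d' (E i) (E' i)))" by simp
qed

section \<open>Closure of generalised and quasiderivations\<close>

lemma GDer_comp_ph: "D \<in> GDer n L k r d \<Longrightarrow> D \<circ> ph a b \<in> GDer n L (k + a) (r + b) d"
  unfolding GDer_gder using gder_comp_ph by fastforce

lemma GDer_comm:
  assumes "D \<in> GDer n L k r d" "D' \<in> GDer n L l s d'"
  shows "comm L d d' D D' \<in> GDer n L (k + l) (r + s) (d + d')"
proof -
  obtain E E' where "E 0 = D" "gder k r d E (E n)" "E' 0 = D'" "gder l s d' E' (E' n)"
    using assms unfolding GDer_gder by blast
  then show ?thesis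
    \<comment> \<open>The commutators are taken index by index: index 0 gives the map in question,
      index \<open>n\<close> the outer map.\<close>
    unfolding GDer_gder by (intro exI[of _ "\<lambda>i. comm L d d' (E i) (E' i)"]) (simp add: gder_comm)
qed

lemma QDer_comp_ph: "D \<in> QDer n L k r d \<Longrightarrow> D \<circ> ph a b \<in> QDer n L (k + a) (r + b) d"
  unfolding QDer_gder using gder_comp_ph by blast

lemma QDer_comm:
  "D \<in> QDer n L k r d \<Longrightarrow> D' \<in> QDer n L l s d' \<Longrightarrow>
    comm L d d' D D' \<in> QDer n L (k + l) (r + s) (d + d')"
  unfolding QDer_gder using gder_comm by blast

section \<open>The centroid\<close>

lemma CentroidD:
  assumes "D \<in> Centroid n L k r d"
  shows "D \<in> End_tilde L d"
    "\<And>ds xs i. length xs = n \<Longrightarrow> homs L ds xs \<Longrightarrow> i < n \<Longrightarrow>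
      D (br L xs) = T_term L k r d ds xs i D"
  using assms unfolding Centroid_def by blast+

lemma Centroid_comp_ph:
  assumes "D \<in> Centroid n L k r d"
  shows "D \<circ> ph a b \<in> Centroid n L (k + a) (r + b) d"
proof -
  have "D (ph a b (br L xs)) = T_term L (k + a) (r + b) d ds xs i (D \<circ> ph a b)"
    if "length xs = n" "homs L ds xs" "i < n" for ds xs i
    using that CentroidD(2)[OF assms, of "map (ph a b) xs" ds i]
    by (simp add: ph_br homs_map_ph T_term_map_ph)
  then show ?thesis
    using CentroidD(1)[OF assms] by (auto simp: Centroid_def comp_ph_End_tilde)
qed

text \<open>Both maps can be moved into the same slot \<open>i\<close>, so only a diagonal term
  arises and no sum has to be expanded.\<close>

lemma Centroid_comp_br:
  assumes D: "D \<in> Centroid n L k r d" and D': "D' \<in> Centroid n L l s d'"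
    and xs: "length xs = n" "homs L ds xs" and i: "i < n"
  shows "D (D' (br L xs)) = T_term L (k + l) (r + s) (d + d') ds xs i (D \<circ> D')"
proof -
  let ?ys = "(map (ph l s) xs)[i := D' (xs ! i)]" and ?es = "ds[i := d' + ds ! i]"
  interpret D: module_hom "scl L" "scl L" D
    by (rule End_tildeD(1)[OF CentroidD(1)[OF D]])
  have "D (br L ?ys) = T_term L k r d ?es ?ys i D"
    by (rule CentroidD(2)[OF D]) (use xs i CentroidD(1)[OF D'] homs_slot in auto)
  then have "D (D' (br L xs)) = pair_term k r d l s d' ds xs i i D D'"
    unfolding CentroidD(2)[OF D' xs i] T_term_ph[of l s]
    by (simp add: D.scale T_term_slot[OF xs i i CentroidD(1)[OF D]])
  then show ?thesis by (simp add: pair_term_diag)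
qed

lemma Centroid_comm:
  assumes D: "D \<in> Centroid n L k r d" and D': "D' \<in> Centroid n L l s d'"
  shows "comm L d d' D D' \<in> Centroid n L (k + l) (r + s) (d + d')"
  unfolding Centroid_def
proof (intro CollectI conjI allI impI)
  show "comm L d d' D D' \<in> End_tilde L (d + d')"
    by (intro comm_End_tilde CentroidD(1)[OF D] CentroidD(1)[OF D'])
next
  fix ds xs i assume xs: "length xs = n" "homs L ds xs" and i: "i < n"
  have "comm L d d' D D' (br L xs) = D (D' (br L xs)) - scl L (eps L d d') (D' (D (br L xs)))"
    by (simp add: comm_def)
  then show "comm L d d' D D' (br L xs) =
      T_term L (k + l) (r + s) (d + d') ds xs i (comm L d d' D D')"
    by (simp add: Centroid_comp_br[OF D D' xs i] Centroid_comp_br[OF D' D xs i] T_term_comm[OF xs(1) i]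
        add.commute[of l k] add.commute[of s r] add.commute[of d' d])
qed

section \<open>Central derivations\<close>

lemma ZDer_iff:
  "D \<in> ZDer n L k r d \<longleftrightarrow> D \<in> End_tilde L d \<and> (\<forall>ds xs. length xs = n \<longrightarrow> homs L ds xs \<longrightarrow>
    D (br L xs) = 0 \<and> (\<forall>i<n. br L ((map (ph k r) xs)[i := D (xs ! i)]) = 0))"
proof -
  have n: "0 < n" using two_le_n by simp
  have "(\<forall>i<n. v = scl L (c i) (w i) \<and> scl L (c i) (w i) = 0) \<longleftrightarrow> v = 0 \<and> (\<forall>i<n. w i = 0)"
    if "\<forall>i. c i \<noteq> 0" for v w c
    using n that by auto
  from this[of "\<lambda>i. eps L d (sum_list (take i _))"] show ?thesis
    unfolding ZDer_def T_term_ph by simp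
qed

lemma ZDerD:
  assumes "D \<in> ZDer n L k r d"
  shows "D \<in> End_tilde L d"
    "\<And>ds xs. length xs = n \<Longrightarrow> homs L ds xs \<Longrightarrow> D (br L xs) = 0"
    "\<And>ds xs i. length xs = n \<Longrightarrow> homs L ds xs \<Longrightarrow> i < n \<Longrightarrow>
      br L ((map (ph k r) xs)[i := D (xs ! i)]) = 0"
  using assms unfolding ZDer_iff by blast+

lemma ZDer_comp_ph:
  assumes "D \<in> ZDer n L k r d"
  shows "D \<circ> ph a b \<in> ZDer n L (k + a) (r + b) d"
proof -
  have "br L ((map (ph (k + a) (r + b)) xs)[i := D (ph a b (xs ! i))]) = 0"
    if "length xs = n" "homs L ds xs" "i < n" for ds xs i
    using that ZDerD(3)[OF assms, of "map (ph a b) xs" ds i]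
    by (simp add: homs_map_ph ph_ph comp_def)
  moreover have "D (ph a b (br L xs)) = 0" if "length xs = n" "homs L ds xs" for ds xs
    using that ZDerD(2)[OF assms, of "map (ph a b) xs" ds] by (simp add: ph_br homs_map_ph)
  ultimately show ?thesis
    using ZDerD(1)[OF assms] unfolding ZDer_iff by (auto simp: comp_ph_End_tilde)
qed

text \<open>After \<open>D'\<close> has acted the arguments are still homogeneous, so the defining
  condition on \<open>D\<close> kills each term, diagonal or not.\<close>

lemma ZDer_pair_term:
  assumes D: "D \<in> ZDer n L k r d" and D': "D' \<in> End_tilde L d'"
    and xs: "length xs = n" "homs L ds xs" and ij: "i < n" "j < n"
  shows "pair_term k r d l s d' ds xs i j D D' = 0"
proof -
  have "br L ((map (ph k r) ((map (ph l s) xs)[i := D' (xs ! i)]))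
      [j := D (((map (ph l s) xs)[i := D' (xs ! i)]) ! j)]) = 0"
    by (rule ZDerD(3)[OF D]) (use xs ij D' homs_slot in auto)
  then show ?thesis
    by (simp add: T_term_slot[OF xs ij ZDerD(1)[OF D], symmetric] T_term_ph)
qed

lemma ZDer_comm_Der:
  assumes D: "D \<in> ZDer n L k r d" and D': "D' \<in> Der n L l s d'"
  shows "comm L d d' D D' \<in> ZDer n L (k + l) (r + s) (d + d')"
proof -
  note g = Der_gder[OF D']
  note Dt = ZDerD(1)[OF D] and Dt' = gderD(1)[OF g]
  interpret D: module_hom "scl L" "scl L" D by (rule End_tildeD(1)[OF Dt])
  interpret D': module_hom "scl L" "scl L" D' by (rule End_tildeD(1)[OF Dt'])
  have slot: "T_term L (k + l) (r + s) (d + d') ds xs i (comm L d d' D D') = 0"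
    if xs: "length xs = n" "homs L ds xs" and i: "i < n" for ds xs i
  proof -
    \<comment> \<open>The vanishing term T_i(D) is fed to \<open>D'\<close>, whose derivation law
      expands it over all slots.\<close>
    have "0 = D' (T_term L k r d ds xs i D)"
      by (simp add: T_term_ph ZDerD(3)[OF D xs i])
    also have "\<dots> = (\<Sum>j<n. pair_term l s d' k r d ds xs i j D' D)"
      by (rule gder_T_term[OF g Dt xs i])
    \<comment> \<open>By \<open>pair_term_swap\<close> an off-diagonal term is a multiple of one
      where \<open>D\<close> acts after \<open>D'\<close>, and that vanishes by
      \<open>ZDer_pair_term\<close>.\<close>
    also have "\<dots> = (\<Sum>j<n. if i = j then pair_term l s d' k r d ds xs i i D' D else 0)"
      by (rule sum.cong) (auto simp: pair_term_swap[of i _ l] ZDer_pair_term[OF D Dt' xs _ i])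
    also have "\<dots> = pair_term l s d' k r d ds xs i i D' D" using i by simp
    finally have "T_term L (k + l) (r + s) (d + d') ds xs i (D' \<circ> D) = 0"
      by (simp add: pair_term_diag add.commute)
    moreover have "T_term L (k + l) (r + s) (d + d') ds xs i (D \<circ> D') = 0"
      using ZDer_pair_term[OF D Dt' xs i i] by (simp add: pair_term_diag)
    ultimately show ?thesis by (simp add: T_term_comm[OF xs(1) i])
  qed
  have "comm L d d' D D' (br L xs) = 0" if xs: "length xs = n" "homs L ds xs" for ds xs
  proof -
    \<comment> \<open>Each summand of \<open>D' (br L xs)\<close> is a multiple of a bracket of
      homogeneous elements, and \<open>D\<close> kills such brackets.\<close>
    have "D (T_term L l s d' ds xs i D') = 0" if i: "i < n" for i
      unfolding T_term_ph using ZDerD(2)[OF D _ homs_slot[OF xs(2) _ Dt']] xs(1) i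
      by (simp add: D.scale)
    then have "D (D' (br L xs)) = 0"
      by (simp add: gderD(3)[OF g xs] D.sum)
    moreover have "D' (D (br L xs)) = 0" by (simp add: ZDerD(2)[OF D xs])
    ultimately show ?thesis by (simp add: comm_def)
  qed
  with slot show ?thesis
    unfolding ZDer_def using comm_End_tilde[OF Dt Dt'] by auto
qed

section \<open>The shifts by \<alpha> and \<beta>, and the conclusion\<close>

lemma omega_ph: "omega L D = D \<circ> ph 1 0"
  and Omega_ph: "Omega L D = D \<circ> ph 0 1"
  by (simp_all add: omega_def Omega_def ph_def)

end

theorem proposition5p11:
  fixes L :: "('k::field, 'g::ab_group_add, 'v::ab_group_add) bihom_color"
    and n :: nat
  assumes "CHAR('k) \<noteq> 2"
    and "n_bihom_lie_color_algebra n L"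
    and "regular n L"
  shows
    "(\<forall>k r d. \<forall>D\<in>GDer n L k r d. omega L D \<in> GDer n L (k + 1) r d) \<and>
     (\<forall>k r d. \<forall>D\<in>GDer n L k r d. Omega L D \<in> GDer n L k (r + 1) d) \<and>
     (\<forall>k r d l s d'. \<forall>D\<in>GDer n L k r d. \<forall>D'\<in>GDer n L l s d'.
        comm L d d' D D' \<in> GDer n L (k + l) (r + s) (d + d')) \<and>
     (\<forall>k r d. \<forall>D\<in>QDer n L k r d. omega L D \<in> QDer n L (k + 1) r d) \<and>
     (\<forall>k r d. \<forall>D\<in>QDer n L k r d. Omega L D \<in> QDer n L k (r + 1) d) \<and>
     (\<forall>k r d l s d'. \<forall>D\<in>QDer n L k r d. \<forall>D'\<in>QDer n L l s d'.
        comm L d d' D D' \<in> QDer n L (k + l) (r + s) (d + d')) \<and>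
     (\<forall>k r d. \<forall>D\<in>Centroid n L k r d. omega L D \<in> Centroid n L (k + 1) r d) \<and>
     (\<forall>k r d. \<forall>D\<in>Centroid n L k r d. Omega L D \<in> Centroid n L k (r + 1) d) \<and>
     (\<forall>k r d l s d'. \<forall>D\<in>Centroid n L k r d. \<forall>D'\<in>Centroid n L l s d'.
        comm L d d' D D' \<in> Centroid n L (k + l) (r + s) (d + d')) \<and>
     (\<forall>k r d. \<forall>D\<in>ZDer n L k r d. omega L D \<in> ZDer n L (k + 1) r d) \<and>
     (\<forall>k r d. \<forall>D\<in>ZDer n L k r d. Omega L D \<in> ZDer n L k (r + 1) d) \<and>
     (\<forall>k r d l s d'. \<forall>D\<in>ZDer n L k r d. \<forall>D'\<in>Der n L l s d'.
        comm L d d' D D' \<in> ZDer n L (k + l) (r + s) (d + d'))"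
proof -
  interpret regular_bihom_color n L
    using assms by unfold_locales
  note shift_a = GDer_comp_ph[where a = 1 and b = 0] QDer_comp_ph[where a = 1 and b = 0]
    Centroid_comp_ph[where a = 1 and b = 0] ZDer_comp_ph[where a = 1 and b = 0]
  note shift_b = GDer_comp_ph[where a = 0 and b = 1] QDer_comp_ph[where a = 0 and b = 1]
    Centroid_comp_ph[where a = 0 and b = 1] ZDer_comp_ph[where a = 0 and b = 1]
  show ?thesis
    unfolding omega_ph Omega_ph
    using shift_a shift_b GDer_comm QDer_comm Centroid_comm ZDer_comm_Der
    \<comment> \<open>The shift by (1, 0) or (0, 1) leaves one index in the form
      \<open>k + 0\<close> or \<open>r + 0\<close>.\<close>
    unfolding add_0_right by simp
qed

end
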